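(* Let $G$ be a connected co-biconvex graph with $\delta(G)\geq 2$, let $U$ be its set of universal vertices, and let $\alpha_1,\alpha_2$ be the independence numbers of the auxiliary interval graphs $H_1,H_2$ of $G-U$ described in the context. Then: (i) if $|U|=1$, then $\gamma_{\times 3}(G)=4$ if $\alpha_1+\alpha_2\geq 3$, and $\gamma_{\times 3}(G)=5$ if $\alpha_1+\alpha_2=2$; (ii) if $|U|=2$ then $\gamma_{\times 3}(G)=4$; (iii) if $|U|\geq 3$ then $\gamma_{\times 3}(G)=3$; (iv) if $|U|=0$ and $\alpha_1+\alpha_2\geq 4$ then $\gamma_{\times 3}(G)=4$; (v) if $|U|=0$ and $\alpha_1=\alpha_2=1$ then $\gamma_{\times 3}(G)=6$; (vi) if $|U|=0$ and $\alpha_1+\alpha_2=3$ then $\gamma_{\times 3}(G)=5$.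
   Context: For a graph $G$ with vertices $v_1,\dots,v_n$, $M^*(G)$ is the $0,1$-matrix with entry $(i,j)=1$ iff $i=j$ or $v_iv_j\in E(G)$. $G$ is co-biconvex if the rows of $M^*(G)$ can be permuted so the 0's in every column are consecutive. A vertex is universal if adjacent to all others; $U$ is the set of universal vertices, and $G-U$ is co-biconvex without universal vertices. For a co-biconvex graph $G'$ without universal vertices: fix an ordering $v_1,\dots,v_n$ (rows and columns of $M^*(G')$ in this order) in which the 0's of each column are consecutive; $C_1$ is the set of vertices whose column has its 0's below the diagonal and $C_2$ those whose column has its 0's above; they partition $V(G')$, are cliques, and we may take $C_1=\{v_1,\dots,v_r\}$, $C_2=\{v_{r+1},\dots,v_n\}$. For $v_i\in C_1$ (resp. $C_2$), if the 0's of column $i$ occupy rows $p,\dots,p+s$, set $I_i=[p,p+s]$. $H_1$ is the intersection graph of $\{I_i:v_i\in C_1\}$ and $H_2$ of $\{I_i:v_i\in C_2\}$; equivalently, two vertices of $C_1$ are adjacent in $H_1$ iff some vertex of $C_2$ is non-adjacent to both (symmetrically for $H_2$). $\delta(G)$ is the minimum degree, $N_G[v]$ the closed neighborhood; $D$ is a $k$-tuple dominating set if $|N_G[v]\cap D|\geq k$ for all $v$; $\gamma_{\times k}(G)$ is the minimum size of such a set. *)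

theory Defs
  imports "Graph_Theory.Digraph" "Graph_Theory.Digraph_Component"
    "HOL-Combinatorics.Permutations" Complex_Main
begin

text \<open>
  Finite simple graphs are those of the locale \<^locale>\<open>graph\<close>: each undirected edge is a pair of
  opposite arcs, without loops and parallel arcs, so the out-degree of a vertex is its degree.
\<close>

definition min_degree :: "('a, 'b) pre_digraph \<Rightarrow> nat" where
  "min_degree G = Min (out_degree G ` verts G)"

definition closed_nbhd :: "('a, 'b) pre_digraph \<Rightarrow> 'a \<Rightarrow> 'a set" where
  "closed_nbhd G v = insert v {w. v \<rightarrow>\<^bsub>G\<^esub> w}"

definition universal_vertices :: "('a, 'b) pre_digraph \<Rightarrow> 'a set" where
  "universal_vertices G = {v \<in> verts G. \<forall>w \<in> verts G. w \<noteq> v \<longrightarrow> v \<rightarrow>\<^bsub>G\<^esub> w}"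

definition k_tuple_dominating :: "nat \<Rightarrow> ('a, 'b) pre_digraph \<Rightarrow> 'a set \<Rightarrow> bool" where
  "k_tuple_dominating k G D \<longleftrightarrow>
     D \<subseteq> verts G \<and> (\<forall>v \<in> verts G. k \<le> card (closed_nbhd G v \<inter> D))"

text \<open>Meaningful only when some \<open>k\<close>-tuple dominating set exists, i.e.\ when every closed
  neighbourhood has at least \<open>k\<close> elements.\<close>

definition k_tuple_domination_number :: "nat \<Rightarrow> ('a, 'b) pre_digraph \<Rightarrow> nat" where
  "k_tuple_domination_number k G = Min (card ` {D. k_tuple_dominating k G D})"

definition independent_set :: "('a, 'b) pre_digraph \<Rightarrow> 'a set \<Rightarrow> bool" where
  "independent_set H S \<longleftrightarrow> S \<subseteq> verts H \<and> (\<forall>u \<in> S. \<forall>v \<in> S. \<not> u \<rightarrow>\<^bsub>H\<^esub> v)"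

definition independence_number :: "('a, 'b) pre_digraph \<Rightarrow> nat" where
  "independence_number H = Max (card ` {S. independent_set H S})"

text \<open>The intersection graph of an indexed family has the indices as vertices, so equal members
  with different indices give different, adjacent vertices.\<close>

definition intersection_graph :: "'i set \<Rightarrow> ('i \<Rightarrow> 'c set) \<Rightarrow> 'i pair_pre_digraph" where
  "intersection_graph A F =
     \<lparr> pverts = A, parcs = {(i, j). i \<in> A \<and> j \<in> A \<and> i \<noteq> j \<and> F i \<inter> F j \<noteq> {}} \<rparr>"

text \<open>Rows, columns and the vertices of an ordering \<open>vs\<close> are numbered from \<open>0\<close>.\<close>

definition vertex_ordering :: "('a, 'b) pre_digraph \<Rightarrow> 'a list \<Rightarrow> bool" where
  "vertex_ordering G vs \<longleftrightarrow> distinct vs \<and> set vs = verts G"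

definition Mstar :: "('a, 'b) pre_digraph \<Rightarrow> 'a list \<Rightarrow> nat \<Rightarrow> nat \<Rightarrow> nat" where
  "Mstar G vs i j = (if i = j \<or> vs ! i \<rightarrow>\<^bsub>G\<^esub> vs ! j then 1 else 0)"

definition zero_rows :: "nat \<Rightarrow> (nat \<Rightarrow> nat \<Rightarrow> nat) \<Rightarrow> nat \<Rightarrow> nat set" where
  "zero_rows n M j = {i. i < n \<and> M i j = 0}"

text \<open>A column without zeros is allowed (\<open>{p..q}\<close> with \<open>q < p\<close>).\<close>

definition consecutive_zeros :: "nat \<Rightarrow> (nat \<Rightarrow> nat \<Rightarrow> nat) \<Rightarrow> bool" where
  "consecutive_zeros n M \<longleftrightarrow> (\<forall>j < n. \<exists>p q. zero_rows n M j = {p..q})"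

definition co_biconvex :: "('a, 'b) pre_digraph \<Rightarrow> bool" where
  "co_biconvex G \<longleftrightarrow>
     (\<exists>vs \<pi>. vertex_ordering G vs \<and> \<pi> permutes {..<length vs} \<and>
        consecutive_zeros (length vs) (\<lambda>i j. Mstar G vs (\<pi> i) j))"

text \<open>The orderings below arrange rows and columns of the matrix simultaneously.\<close>

definition consecutive_ordering :: "('a, 'b) pre_digraph \<Rightarrow> 'a list \<Rightarrow> bool" where
  "consecutive_ordering G vs \<longleftrightarrow>
     vertex_ordering G vs \<and> consecutive_zeros (length vs) (Mstar G vs)"

text \<open>
  From here on \<open>G\<close> is meant to have no universal vertex, so that every column of its matrix contains
  a zero. The classes \<open>C\<^sub>1\<close> and \<open>C\<^sub>2\<close> are given by the positions of their vertices in \<open>vs\<close>.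
  It is not required that the vertices of \<open>C\<^sub>1\<close> precede those of \<open>C\<^sub>2\<close> in \<open>vs\<close>; orderings with
  that property are a special case.
\<close>

definition C1 :: "('a, 'b) pre_digraph \<Rightarrow> 'a list \<Rightarrow> nat set" where
  "C1 G vs = {j. j < length vs \<and> (\<forall>i \<in> zero_rows (length vs) (Mstar G vs) j. j < i)}"

definition C2 :: "('a, 'b) pre_digraph \<Rightarrow> 'a list \<Rightarrow> nat set" where
  "C2 G vs = {j. j < length vs \<and> (\<forall>i \<in> zero_rows (length vs) (Mstar G vs) j. i < j)}"

definition zero_interval :: "('a, 'b) pre_digraph \<Rightarrow> 'a list \<Rightarrow> nat \<Rightarrow> real set" where
  "zero_interval G vs j =
     {real (Min (zero_rows (length vs) (Mstar G vs) j)) ..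
      real (Max (zero_rows (length vs) (Mstar G vs) j))}"

definition H1 :: "('a, 'b) pre_digraph \<Rightarrow> 'a list \<Rightarrow> nat pair_pre_digraph" where
  "H1 G vs = intersection_graph (C1 G vs) (zero_interval G vs)"

definition H2 :: "('a, 'b) pre_digraph \<Rightarrow> 'a list \<Rightarrow> nat pair_pre_digraph" where
  "H2 G vs = intersection_graph (C2 G vs) (zero_interval G vs)"

text \<open>Deleting the universal vertices of a co-biconvex graph leaves a graph that has an ordering
  as above.\<close>

lemma filter_consecutive:
  assumes eq: "{i. i < length ws \<and> P (ws ! i)} = {p..q}"
    and PQ: "\<And>x. x \<in> set ws \<Longrightarrow> P x \<Longrightarrow> Q x"
  shows "\<exists>p q. {i. i < length (filter Q ws) \<and> P (filter Q ws ! i)} = {p..q::nat}"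
proof -
  define xs ys zs where "xs = take p ws" and "ys = drop p (take (Suc q) ws)"
    and "zs = drop (max p (Suc q)) ws"
  have ws: "ws = xs @ ys @ zs"
  proof (cases "p \<le> Suc q")
    case True
    have "xs = take p (take (Suc q) ws)" using True by (simp add: xs_def min_def)
    then have "xs @ ys = take (Suc q) ws" unfolding ys_def by (metis append_take_drop_id)
    then show ?thesis using True by (simp add: zs_def max_def flip: append_assoc)
  next
    case False
    then show ?thesis by (simp add: xs_def ys_def zs_def max_def)
  qed
  have iff: "P (ws ! i) \<longleftrightarrow> p \<le> i \<and> i \<le> q" if "i < length ws" for i
    using eq that by (auto simp: set_eq_iff)
  have x: "\<not> P a" if "a \<in> set xs" for a
    using that iff by (auto simp: xs_def in_set_conv_nth)
  have y: "P a" if a: "a \<in> set ys" for a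
  proof -
    obtain i where i: "i < length ys" "a = ys ! i" using a by (auto simp: in_set_conv_nth)
    then have "p + i < length ws" "p + i \<le> q" by (auto simp: ys_def)
    moreover from this have "a = ws ! (p + i)" using i by (simp add: ys_def)
    ultimately show ?thesis using iff by simp
  qed
  have z: "\<not> P a" if a: "a \<in> set zs" for a
  proof -
    obtain i where i: "i < length zs" "a = zs ! i" using a by (auto simp: in_set_conv_nth)
    then have "max p (Suc q) + i < length ws" by (auto simp: zs_def)
    moreover from this have "a = ws ! (max p (Suc q) + i)"
      using i(2) nth_drop[of "max p (Suc q)" ws i] unfolding zs_def by (metis add_leD1 less_imp_le)
    ultimately show ?thesis using iff[of "max p (Suc q) + i"] by auto
  qed
  have fy: "filter Q ys = ys"
  proof (rule filter_True, rule ballI)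
    fix a assume a: "a \<in> set ys"
    then have "a \<in> set ws" by (subst ws) simp
    then show "Q a" using y[OF a] by (rule PQ)
  qed
  define m where "m = length (filter Q xs)"
  have f: "filter Q ws = filter Q xs @ ys @ filter Q zs"
    by (subst ws) (simp add: fy)
  have nx: "\<not> P (filter Q xs ! i)" if "i < length (filter Q xs)" for i
    using x nth_mem[OF that] by auto
  have nz: "\<not> P (filter Q zs ! i)" if "i < length (filter Q zs)" for i
    using z nth_mem[OF that] by auto
  have "{i. i < length (filter Q ws) \<and> P (filter Q ws ! i)} = {m..<m + length ys}"
  proof (rule set_eqI)
    fix x
    show "x \<in> {i. i < length (filter Q ws) \<and> P (filter Q ws ! i)} \<longleftrightarrow> x \<in> {m..<m + length ys}"
      unfolding f m_def using nx nz[of "x - (length (filter Q xs) + length ys)"] y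
      by (cases "x < length (filter Q xs) + length ys") (auto simp: nth_append)
  qed
  also have "\<exists>p q. {m..<m + length ys} = {p..q}"
  proof (cases "ys = []")
    case True
    then have "{m..<m + length ys} = {1..0}" by simp
    then show ?thesis by blast
  next
    case False
    then have "{m..<m + length ys} = {m..m + length ys - 1}" by (cases ys) auto
    then show ?thesis by blast
  qed
  finally show ?thesis .
qed

lemma co_biconvex_consecutive_ordering:
  assumes "graph G" and "co_biconvex G"
  shows "\<exists>vs. consecutive_ordering (G \<restriction> (verts G - universal_vertices G)) vs"
proof -
  interpret graph G by fact
  define W where "W = verts G - universal_vertices G"
  obtain vs \<pi> where vs: "distinct vs" "set vs = verts G" and p: "\<pi> permutes {..<length vs}"
    and cz: "consecutive_zeros (length vs) (\<lambda>i j. Mstar G vs (\<pi> i) j)"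
    using assms(2) by (auto simp: co_biconvex_def vertex_ordering_def)
  define ws where "ws = map (\<lambda>i. vs ! \<pi> i) [0..<length vs]"
  define fs where "fs = filter (\<lambda>x. x \<in> W) ws"
  have lws: "length ws = length vs" by (simp add: ws_def)
  have pl: "\<pi> i < length vs" if "i < length vs" for i
    using permutes_in_image[OF p, of i] that by simp
  have dws: "distinct ws"
    using vs(1) pl permutes_inj[OF p]
    by (auto simp: ws_def distinct_map inj_on_def nth_eq_iff_index_eq)
  have "set ws = (\<lambda>i. vs ! i) ` (\<pi> ` {..<length vs})" by (auto simp: ws_def)
  also have "\<dots> = set vs" using permutes_image[OF p] by (auto simp: set_conv_nth)
  finally have sws: "set ws = verts G" using vs(2) by simp
  have dfs: "distinct fs" and sfs: "set fs = W"
    using dws sws by (auto simp: fs_def W_def)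
  have "\<exists>p q. zero_rows (length fs) (Mstar (G \<restriction> W) fs) j = {p..q}" if j: "j < length fs" for j
  proof -
    define v where "v = fs ! j"
    have vW: "v \<in> W" using j sfs by (auto simp: v_def)
    then have "v \<in> set vs" using vs(2) by (simp add: W_def)
    then obtain c where c: "c < length vs" "vs ! c = v" by (auto simp: in_set_conv_nth)
    define P where "P = (\<lambda>x. x \<noteq> v \<and> \<not> x \<rightarrow>\<^bsub>G\<^esub> v)"
    have "\<exists>p q. zero_rows (length vs) (\<lambda>i j. Mstar G vs (\<pi> i) j) c = {p..q}"
      by (rule cz[unfolded consecutive_zeros_def, rule_format, OF c(1)])
    then obtain p q where pq: "zero_rows (length vs) (\<lambda>i j. Mstar G vs (\<pi> i) j) c = {p..q}"
      by (elim exE)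
    have "P (ws ! i) \<longleftrightarrow> Mstar G vs (\<pi> i) c = 0" if i: "i < length vs" for i
    proof -
      have "vs ! \<pi> i = v \<longleftrightarrow> \<pi> i = c"
        using nth_eq_iff_index_eq[OF vs(1) pl[OF i] c(1)] c(2) by simp
      then show ?thesis using i c(2) by (simp add: P_def Mstar_def ws_def)
    qed
    then have "{i. i < length ws \<and> P (ws ! i)} = {p..q}"
      unfolding pq[symmetric] zero_rows_def by (auto simp: lws)
    moreover have "x \<in> W" if "x \<in> set ws" "P x" for x
      using that vW sws by (auto simp: W_def P_def universal_vertices_def)
    ultimately have *: "\<exists>p q. {i. i < length fs \<and> P (fs ! i)} = {p..q}"
      unfolding fs_def by (rule filter_consecutive)
    have dom: "x \<rightarrow>\<^bsub>G \<restriction> W\<^esub> v \<longleftrightarrow> x \<rightarrow>\<^bsub>G\<^esub> v" if "x \<in> W" for x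
      using that vW by (auto simp: arcs_ends_conv induce_subgraph_def)
    have "zero_rows (length fs) (Mstar (G \<restriction> W) fs) j = {i. i < length fs \<and> P (fs ! i)}"
    proof -
      have "P (fs ! i) \<longleftrightarrow> Mstar (G \<restriction> W) fs i j = 0" if i: "i < length fs" for i
      proof -
        have "fs ! i = v \<longleftrightarrow> i = j"
          using nth_eq_iff_index_eq[OF dfs i j] by (simp add: v_def)
        moreover have "fs ! i \<in> W" using i sfs nth_mem by blast
        ultimately show ?thesis using dom by (simp add: P_def Mstar_def v_def)
      qed
      then show ?thesis by (auto simp: zero_rows_def)
    qed
    then show ?thesis using * by simp
  qed
  then have "consecutive_ordering (G \<restriction> W) fs"
    using dfs sfs by (auto simp: consecutive_ordering_def vertex_ordering_def consecutive_zeros_def)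
  then show ?thesis unfolding W_def by blast
qed

end

theory Submission
  imports Defs "HOL-Library.Disjoint_Sets"
begin

text \<open>
  The classes \<open>C\<^sub>1\<close> and \<open>C\<^sub>2\<close> are cliques, so a vertex of one of them has all its non-neighbours in
  the other one, and \<open>D\<close> is triple dominating iff every vertex has at most \<open>card D - 3\<close>
  non-neighbours in \<open>D\<close>. An independent set of an auxiliary interval graph is a set of vertices
  of one class with pairwise disjoint sets of non-neighbours, so every vertex misses at most one of
  its elements; this gives the small dominating sets. Conversely, two vertices adjacent in an
  auxiliary graph have a common non-neighbour, and if an independence number is 1, then by Helly's
  theorem for intervals some vertex misses the whole class, so that at least three elements of \<open>D\<close>
  lie in the other class. These facts give the lower bounds.
\<close>

section \<open>Helly's theorem for intervals and packings of sets\<close>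

text \<open>Pairwise intersection puts every left endpoint below every right endpoint, so the
  largest left endpoint is a common point.\<close>

lemma Helly_intervals:
  fixes p q :: "'i \<Rightarrow> 'b::linorder"
  assumes "finite I" "I \<noteq> {}"
    and "\<And>i. i \<in> I \<Longrightarrow> F i = {p i..q i}"
    and "\<And>i j. i \<in> I \<Longrightarrow> j \<in> I \<Longrightarrow> F i \<inter> F j \<noteq> {}"
  shows "\<exists>x. \<forall>i\<in>I. x \<in> F i"
proof (intro exI ballI)
  fix j assume j: "j \<in> I"
  have "p i \<le> q j" if i: "i \<in> I" for i
  proof -
    obtain x where "x \<in> F i" "x \<in> F j" using assms(4)[OF i j] by blast
    then show ?thesis using assms(3)[OF i] assms(3)[OF j] by auto
  qed
  then show "Max (p ` I) \<in> F j"
    using assms(1,2,3) j by auto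
qed

text \<open>For an intersection graph this is the independence number. The form for set families
  covers both sets of non-neighbours and real intervals.\<close>

definition packing_number :: "('a \<Rightarrow> 'b set) \<Rightarrow> 'a set \<Rightarrow> nat" where
  "packing_number Z A = Max (card ` {S. S \<subseteq> A \<and> disjoint_family_on Z S})"

lemma packing_number_ge:
  assumes "finite A" "S \<subseteq> A" "disjoint_family_on Z S"
  shows "card S \<le> packing_number Z A"
  unfolding packing_number_def using assms by (intro Max_ge) auto

lemma packing_number_obtain:
  assumes "finite A" "k \<le> packing_number Z A"
  obtains S where "S \<subseteq> A" "disjoint_family_on Z S" "card S = k"
proof -
  have "packing_number Z A \<in> card ` {S. S \<subseteq> A \<and> disjoint_family_on Z S}"
    unfolding packing_number_def using assms(1)
    by (intro Max_in) (auto simp: disjoint_family_on_def)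
  then obtain T where T: "T \<subseteq> A" "disjoint_family_on Z T" "card T = packing_number Z A"
    by auto
  obtain S where "S \<subseteq> T" "card S = k"
    using T(3) assms(2) by (metis obtain_subset_with_card_n)
  moreover from this have "disjoint_family_on Z S"
    using T(2) by (auto simp: disjoint_family_on_def)
  ultimately show thesis using that[of S] T(1) by blast
qed

section \<open>Triple domination in two cliques with universal vertices\<close>

text \<open>\<open>A\<close> and \<open>B\<close> are cliques covering the non-universal vertices, and \<open>Z v\<close> is the set of vertices
  different from \<open>v\<close> and not adjacent to it.\<close>

locale co_bipartite =
  fixes U A B :: "'a set" and Z :: "'a \<Rightarrow> 'a set"
  assumes finite: "finite U" "finite A" "finite B"
    and disjoint: "U \<inter> A = {}" "U \<inter> B = {}" "A \<inter> B = {}"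
    and Z_U: "u \<in> U \<Longrightarrow> Z u = {}"
    and Z_A: "a \<in> A \<Longrightarrow> Z a \<subseteq> B \<and> Z a \<noteq> {}"
    and Z_B: "b \<in> B \<Longrightarrow> Z b \<subseteq> A \<and> Z b \<noteq> {}"
    and Z_sym: "a \<in> A \<Longrightarrow> b \<in> B \<Longrightarrow> b \<in> Z a \<longleftrightarrow> a \<in> Z b"
    and degree: "v \<in> U \<union> A \<union> B \<Longrightarrow> 3 \<le> card (U \<union> A \<union> B - Z v)"
    and nonempty: "U \<union> A \<union> B \<noteq> {}"
    and Helly_A: "A \<noteq> {} \<Longrightarrow> (\<And>x y. x \<in> A \<Longrightarrow> y \<in> A \<Longrightarrow> Z x \<inter> Z y \<noteq> {}) \<Longrightarrow> \<exists>b. \<forall>a\<in>A. b \<in> Z a"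
    and Helly_B: "B \<noteq> {} \<Longrightarrow> (\<And>x y. x \<in> B \<Longrightarrow> y \<in> B \<Longrightarrow> Z x \<inter> Z y \<noteq> {}) \<Longrightarrow> \<exists>a. \<forall>b\<in>B. a \<in> Z b"
begin

text \<open>The assumptions are symmetric in the two cliques, so every result about \<open>A\<close>
  yields its counterpart for \<open>B\<close>.\<close>

lemma swap: "co_bipartite U B A Z"
proof
  show "3 \<le> card (U \<union> B \<union> A - Z v)" if "v \<in> U \<union> B \<union> A" for v
    using degree[of v] that by (simp add: Un_ac)
  show "a \<in> Z b \<longleftrightarrow> b \<in> Z a" if "b \<in> B" "a \<in> A" for a b
    using Z_sym[OF that(2,1)] by simp
qed (use finite disjoint Z_U Z_A Z_B nonempty in \<open>simp_all add: Un_ac Int_commute Helly_A Helly_B\<close>)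

text \<open>The complement of \<open>Z v\<close> is the closed neighbourhood of \<open>v\<close>, so
  \<open>D - Z v\<close> is the part of \<open>D\<close> that dominates \<open>v\<close>.\<close>

definition triple_dominating :: "'a set \<Rightarrow> bool" where
  "triple_dominating D \<longleftrightarrow>
     D \<subseteq> U \<union> A \<union> B \<and> (\<forall>v \<in> U \<union> A \<union> B. 3 \<le> card (D - Z v))"

definition triple_number :: nat where
  "triple_number = Min (card ` {D. triple_dominating D})"

lemma swap_triple_dominating: "co_bipartite.triple_dominating U B A Z = triple_dominating"
  unfolding co_bipartite.triple_dominating_def[OF swap] triple_dominating_def
  by (simp add: Un_ac)

lemma triple_number_eqI:
  assumes "triple_dominating D" "card D = m" "\<And>D. triple_dominating D \<Longrightarrow> m \<le> card D"
  shows "triple_number = m"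
  unfolding triple_number_def
proof (rule Min_eqI)
  have "{D. triple_dominating D} \<subseteq> Pow (U \<union> A \<union> B)"
    by (auto simp: triple_dominating_def)
  then show "finite (card ` {D. triple_dominating D})"
    by (intro finite_imageI) (rule finite_subset, use finite in auto)
qed (use assms in auto)

lemma triple_dominating_finite: "triple_dominating D \<Longrightarrow> finite D"
  using finite by (auto simp: triple_dominating_def intro: finite_subset[of D "U \<union> A \<union> B"])

text \<open>At least three elements of \<open>D\<close> dominate \<open>v\<close>, and none of them
  lies in \<open>T\<close>. The bounds 3, 4 and 5 below use a set \<open>T\<close> with 0, 1 and 2
  elements.\<close>

lemma card_ge_common_nonneighbour:
  assumes D: "triple_dominating D" and "v \<in> U \<union> A \<union> B" "T \<subseteq> D" "T \<subseteq> Z v"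
  shows "card T + 3 \<le> card D"
proof -
  have fD: "finite D" using D by (rule triple_dominating_finite)
  have "3 \<le> card (D - Z v)" using assms by (simp add: triple_dominating_def)
  moreover have "card (D - Z v) \<le> card (D - T)"
    using fD assms by (intro card_mono) auto
  moreover have "card (D - T) = card D - card T" "card T \<le> card D"
    using fD assms(3) finite_subset[OF assms(3) fD] by (simp_all add: card_Diff_subset card_mono)
  ultimately show ?thesis by linarith
qed

lemma card_ge_3:
  assumes "triple_dominating D"
  shows "3 \<le> card D"
proof -
  obtain v where "v \<in> U \<union> A \<union> B" using nonempty by blast
  then show ?thesis using card_ge_common_nonneighbour[OF assms, of v "{}"] by simp
qed

text \<open>Three elements do not fit into \<open>U\<close>, so \<open>D\<close> contains a vertex
  of \<open>A\<close> or \<open>B\<close>, and such a vertex has a non-neighbour.\<close>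

lemma card_ge_4:
  assumes D: "triple_dominating D" and "card U \<le> 2"
  shows "4 \<le> card D"
proof -
  have "\<not> D \<subseteq> U" using card_mono[of U D] card_ge_3[OF D] assms(2) finite(1) by auto
  then obtain d where d: "d \<in> D" "d \<in> A \<union> B" using D by (auto simp: triple_dominating_def)
  have "\<exists>v \<in> U \<union> A \<union> B. d \<in> Z v"
  proof (cases "d \<in> A")
    case True
    then show ?thesis using Z_A[of d] Z_sym[of d] by blast
  next
    case False
    then show ?thesis using d Z_B[of d] Z_sym[of _ d] by blast
  qed
  then obtain v where "v \<in> U \<union> A \<union> B" "{d} \<subseteq> Z v" by blast
  then show ?thesis using card_ge_common_nonneighbour[OF D, of v "{d}"] d by simp
qed

text \<open>A set larger than every packing contains two vertices with a common non-neighbour, which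
  therefore misses two elements of \<open>D\<close>.\<close>

lemma card_ge_5:
  assumes D: "triple_dominating D" and S: "S \<subseteq> A" "S \<subseteq> D" and "packing_number Z A < card S"
  shows "5 \<le> card D"
proof -
  have "\<not> disjoint_family_on Z S" using packing_number_ge[OF finite(2) S(1), of Z] assms(4) by linarith
  then obtain x y v where xy: "x \<in> S" "y \<in> S" "x \<noteq> y" and v: "v \<in> Z x" "v \<in> Z y"
    by (auto simp: disjoint_family_on_def)
  have "x \<in> A" "y \<in> A" using xy S by auto
  moreover from this have "v \<in> B" using Z_A v by blast
  ultimately have "v \<in> B" "{x, y} \<subseteq> Z v" using v Z_sym by auto
  then show ?thesis using card_ge_common_nonneighbour[OF D, of v "{x, y}"] xy S by auto
qed

text \<open>A closed neighbourhood has at least three elements, too many for \<open>U\<close> alone.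
  A vertex of either class has a non-neighbour in the other class.\<close>

lemma classes_nonempty:
  assumes "card U \<le> 2"
  shows "A \<noteq> {}" "B \<noteq> {}"
proof -
  obtain v where "v \<in> U \<union> A \<union> B" using nonempty by blast
  then have "3 \<le> card (U \<union> A \<union> B - Z v)" by (rule degree)
  also have "\<dots> \<le> card (U \<union> A \<union> B)" using finite by (intro card_mono) auto
  finally have "A \<union> B \<noteq> {}" using assms by auto
  then show "A \<noteq> {}" "B \<noteq> {}" using Z_A Z_B by blast+
qed

text \<open>A single vertex of \<open>A\<close> would be missed by all of \<open>B\<close>, leaving
  at most two vertices in its closed neighbourhood.\<close>

lemma card_A_ge_2:
  assumes "card U \<le> 1"
  shows "2 \<le> card A"
proof (rule ccontr)
  assume "\<not> 2 \<le> card A"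
  moreover have "A \<noteq> {}" using assms by (intro classes_nonempty) simp
  ultimately have "card A = 1" using finite(2) card_gt_0_iff[of A] by linarith
  then obtain a where a: "A = {a}" by (auto simp: card_1_singleton_iff)
  then have "B \<subseteq> Z a" using Z_B Z_sym by blast
  then have "U \<union> A \<union> B - Z a \<subseteq> insert a U" using a by auto
  then have "card (U \<union> A \<union> B - Z a) \<le> card (insert a U)" using finite by (intro card_mono) auto
  also have "\<dots> \<le> 2" using assms finite(1) by (simp add: card_insert_if)
  finally show False using degree[of a] a by simp
qed

lemma packing_number_pos:
  assumes "A \<noteq> {}"
  shows "1 \<le> packing_number Z A"
proof -
  obtain a where "a \<in> A" using assms by blast
  then have "card {a} \<le> packing_number Z A"
    by (intro packing_number_ge finite) (auto simp: disjoint_family_on_def)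
  then show ?thesis by simp
qed

text \<open>With packing number 1 the sets \<open>Z x\<close> for \<open>x\<close> in
  \<open>A\<close> pairwise meet, so the Helly property supplies a vertex missing all of
  \<open>A\<close>.\<close>

lemma packing_number_1:
  assumes "packing_number Z A = 1" "A \<noteq> {}"
  obtains b where "b \<in> B" "Z b = A"
proof -
  have "Z x \<inter> Z y \<noteq> {}" if "x \<in> A" "y \<in> A" for x y
  proof (cases "x = y")
    case True
    then show ?thesis using Z_A that by auto
  next
    case False
    have "\<not> card {x, y} \<le> packing_number Z A" using assms False by simp
    then have "\<not> disjoint_family_on Z {x, y}"
      using packing_number_ge[OF finite(2), of "{x, y}" Z] that by auto
    then show ?thesis by (auto simp: disjoint_family_on_def)
  qed
  from Helly_A[OF assms(2) this] obtain b where b: "\<forall>a\<in>A. b \<in> Z a" ..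
  then have bB: "b \<in> B" using assms(2) Z_A by blast
  have "Z b = A"
  proof
    show "Z b \<subseteq> A" using Z_B[OF bB] ..
    show "A \<subseteq> Z b" using Z_sym[OF _ bB] b by blast
  qed
  with bB show thesis by (rule that)
qed

text \<open>When \<open>U\<close> is empty, a vertex \<open>b\<close> with \<open>Z b = A\<close>
  can be dominated only from \<open>B\<close>.\<close>

lemma card_Int_B_ge_3:
  assumes "packing_number Z A = 1" "A \<noteq> {}" "U = {}" "triple_dominating D"
  shows "3 \<le> card (D \<inter> B)"
proof -
  obtain b where b: "b \<in> B" "Z b = A" using packing_number_1[OF assms(1,2)] .
  have "D \<subseteq> U \<union> A \<union> B" using assms(4) by (simp add: triple_dominating_def)
  then have "D - A = D \<inter> B" using assms(3) disjoint(3) by blast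
  then have "D - Z b = D \<inter> B" using b(2) by simp
  moreover have "3 \<le> card (D - Z b)" using b(1) assms(4) by (simp add: triple_dominating_def)
  ultimately show ?thesis by simp
qed

lemma triple_dominating_all: "triple_dominating (U \<union> A \<union> B)"
  using degree by (simp add: triple_dominating_def)

text \<open>\<open>card_Int_B_ge_3\<close> is applied to the whole vertex set, which is triple
  dominating by the degree condition.\<close>

lemma card_B_ge_3:
  assumes "packing_number Z A = 1" "A \<noteq> {}" "U = {}"
  shows "3 \<le> card B"
  using card_Int_B_ge_3[OF assms triple_dominating_all] by (simp add: Int_absorb1 Un_upper2)

text \<open>Vertices of \<open>A\<close> miss nothing in \<open>W\<close> and \<open>X\<close>, and
  vertices of \<open>B\<close> miss nothing in \<open>W\<close> and \<open>Y\<close>, so only the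
  part in the opposite clique has to be controlled. All upper bounds with at most two universal
  vertices come from here.\<close>

lemma ex_triple_dominating:
  assumes WXY: "W \<subseteq> U" "X \<subseteq> A" "Y \<subseteq> B" and "A \<noteq> {}"
    and a: "\<And>a. a \<in> A \<Longrightarrow> 3 \<le> card W + card X + card (Y - Z a)"
    and b: "\<And>b. b \<in> B \<Longrightarrow> 3 \<le> card W + card Y + card (X - Z b)"
  shows "\<exists>D. triple_dominating D \<and> card D = card W + card X + card Y"
proof -
  have fin: "finite W" "finite X" "finite Y"
    using WXY finite finite_subset by blast+
  have disj: "W \<inter> X = {}" "W \<inter> Y = {}" "X \<inter> Y = {}" using WXY disjoint by blast+
  have c: "card (W \<union> X' \<union> Y') = card W + card X' + card Y'" if "X' \<subseteq> X" "Y' \<subseteq> Y" for X' Y'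
  proof -
    have "finite X'" "finite Y'" using that fin finite_subset by blast+
    moreover have "W \<inter> X' = {}" "(W \<union> X') \<inter> Y' = {}" using that disj by blast+
    ultimately show ?thesis using fin by (simp add: card_Un_disjoint)
  qed
  then have card: "card (W \<union> X \<union> Y) = card W + card X + card Y" by simp
  have "3 \<le> card (W \<union> X \<union> Y - Z v)" if v: "v \<in> U \<union> A \<union> B" for v
  proof -
    consider "v \<in> U" | "v \<in> A" | "v \<in> B" using v by blast
    then show ?thesis
    proof cases
      case 1
      \<comment> \<open>A vertex of \<open>U\<close> misses nothing, so its count is the size of the
        whole set, which the condition at any \<open>a\<close> bounds from below.\<close>
      obtain a where "a \<in> A" using \<open>A \<noteq> {}\<close> by blast
      then have "3 \<le> card W + card X + card (Y - Z a)" by (rule a)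
      also have "\<dots> \<le> card (W \<union> X \<union> Y)" using fin by (simp add: card card_mono)
      finally show ?thesis using 1 Z_U by simp
    next
      case 2
      then have "W \<union> X \<union> Y - Z v = W \<union> X \<union> (Y - Z v)" using WXY Z_A disjoint by blast
      then show ?thesis using a[OF 2] c by simp
    next
      case 3
      then have "W \<union> X \<union> Y - Z v = W \<union> (X - Z v) \<union> Y" using WXY Z_B disjoint by blast
      then show ?thesis using b[OF 3] c by simp
    qed
  qed
  then have "triple_dominating (W \<union> X \<union> Y)" using WXY by (auto simp: triple_dominating_def)
  with card show ?thesis by blast
qed

text \<open>Two members of \<open>S\<close> missed by \<open>b\<close> would share \<open>b\<close>
  as a non-neighbour, so \<open>b\<close> misses at most one member of a packing.\<close>

lemma card_packing_Diff:
  assumes S: "S \<subseteq> A" "disjoint_family_on Z S" and b: "b \<in> B"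
  shows "card S - 1 \<le> card (S - Z b)"
proof -
  have "x = y" if "x \<in> S \<inter> Z b" "y \<in> S \<inter> Z b" for x y
  proof -
    have "b \<in> Z x \<inter> Z y" using that S(1) b Z_sym by blast
    then show ?thesis using that S(2) by (auto simp: disjoint_family_on_def)
  qed
  then have "card (S \<inter> Z b) \<le> 1"
    by (simp add: card_le_Suc0_iff_eq finite_subset[OF S(1) finite(2)])
  moreover have "card (S - Z b) = card S - card (S \<inter> Z b)"
    by (intro card_Diff_subset_Int finite_subset[OF _ finite(2)]) (use S in auto)
  ultimately show ?thesis by linarith
qed

section \<open>Values of the triple domination number\<close>

lemma triple_number_U_ge_3:
  assumes "3 \<le> card U"
  shows "triple_number = 3"
proof -
  obtain D where D: "D \<subseteq> U" "card D = 3" using assms by (metis obtain_subset_with_card_n)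
  have "D - Z v = D" if "v \<in> U \<union> A \<union> B" for v using that D disjoint Z_U Z_A Z_B by blast
  then have "triple_dominating D" using D by (auto simp: triple_dominating_def)
  then show ?thesis using D card_ge_3 by (intro triple_number_eqI)
qed

text \<open>A non-universal vertex is dominated by both universal vertices and by the chosen vertex
  of its own class.\<close>

lemma triple_number_U_2:
  assumes "card U = 2"
  shows "triple_number = 4"
proof -
  obtain a b where ab: "a \<in> A" "b \<in> B" using classes_nonempty assms by fastforce
  have "\<exists>D. triple_dominating D \<and> card D = card U + card {a} + card {b}"
    by (rule ex_triple_dominating) (use ab assms in auto)
  then obtain D where "triple_dominating D" "card D = 4" using assms by auto
  then show ?thesis by (rule triple_number_eqI) (use assms card_ge_4 in auto)
qed

text \<open>The witness is \<open>U\<close>, a packing of two vertices of \<open>A\<close> and one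
  vertex \<open>b\<close> of \<open>B\<close>. A vertex of \<open>B\<close> keeps the universal
  vertex, \<open>b\<close> and at least one member of the packing.\<close>

lemma triple_number_U_1_aux:
  assumes "card U = 1" "2 \<le> packing_number Z A"
  shows "\<exists>D. triple_dominating D \<and> card D = 4"
proof -
  obtain b where b: "b \<in> B" using classes_nonempty assms by auto
  obtain X where X: "X \<subseteq> A" "disjoint_family_on Z X" "card X = 2"
    using packing_number_obtain[OF finite(2) assms(2)] .
  have "\<exists>D. triple_dominating D \<and> card D = card U + card X + card {b}"
  proof (rule ex_triple_dominating)
    show "3 \<le> card U + card {b} + card (X - Z v)" if "v \<in> B" for v
      using card_packing_Diff[OF X(1,2) that] X(3) assms(1) by simp
  qed (use b assms X classes_nonempty in auto)
  moreover have "card U + card X + card {b} = 4" using assms(1) X(3) by simp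
  ultimately show ?thesis by simp
qed

lemma triple_number_U_1_ge_3:
  assumes "card U = 1" "3 \<le> packing_number Z A + packing_number Z B"
  shows "triple_number = 4"
proof -
  have "2 \<le> packing_number Z A \<or> 2 \<le> packing_number Z B" using assms(2) by linarith
  then obtain D where "triple_dominating D" "card D = 4"
    using triple_number_U_1_aux[OF assms(1)]
      co_bipartite.triple_number_U_1_aux[OF swap assms(1)] swap_triple_dominating by auto
  then show ?thesis using card_ge_4 assms(1) by (intro triple_number_eqI) auto
qed

lemma triple_number_U_1_2:
  assumes "card U = 1" "packing_number Z A + packing_number Z B = 2"
  shows "triple_number = 5"
proof -
  have ne: "A \<noteq> {}" "B \<noteq> {}" using classes_nonempty assms by auto
  have 1: "packing_number Z A = 1" "packing_number Z B = 1"
    using packing_number_pos[OF ne(1)] co_bipartite.packing_number_pos[OF swap ne(2)] assms(2)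
    by auto
  have "2 \<le> card A" "2 \<le> card B"
    using card_A_ge_2 co_bipartite.card_A_ge_2[OF swap] assms(1) by auto
  then obtain X Y where XY: "X \<subseteq> A" "card X = 2" "Y \<subseteq> B" "card Y = 2"
    by (metis obtain_subset_with_card_n)
  \<comment> \<open>Each non-universal vertex has two dominators in its own class, and the universal
    vertex is the third.\<close>
  have "\<exists>D. triple_dominating D \<and> card D = card U + card X + card Y"
    by (rule ex_triple_dominating) (use XY assms ne in auto)
  then obtain D where "triple_dominating D" "card D = 5" using XY assms by auto
  then show ?thesis
  proof (rule triple_number_eqI)
    fix D assume D: "triple_dominating D"
    have "D = (D \<inter> U) \<union> (D \<inter> A) \<union> (D \<inter> B)" using D by (auto simp: triple_dominating_def)
    then have "card D \<le> card (D \<inter> U) + card (D \<inter> A) + card (D \<inter> B)"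
      using card_Un_le[of "D \<inter> U" "D \<inter> A"] card_Un_le[of "(D \<inter> U) \<union> (D \<inter> A)" "D \<inter> B"] by simp
    moreover have "card (D \<inter> U) \<le> 1"
      using card_mono[of U "D \<inter> U"] finite(1) assms(1) by auto
    moreover have "4 \<le> card D" using card_ge_4[OF D] assms(1) by simp
    \<comment> \<open>Four elements with at most one in \<open>U\<close> leave three for the two
      classes, so some class receives two, exceeding its packing number 1.\<close>
    ultimately have "1 < card (D \<inter> A) \<or> 1 < card (D \<inter> B)" by linarith
    then show "5 \<le> card D"
      using card_ge_5[OF D, of "D \<inter> A"] 1
        co_bipartite.card_ge_5[OF swap, unfolded swap_triple_dominating, OF D, of "D \<inter> B"] by auto
  qed
qed

text \<open>A packing of three vertices of \<open>A\<close> is joined by one vertex of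
  \<open>B\<close>: vertices of \<open>A\<close> see the whole packing, vertices of \<open>B\<close>
  at least two of its members and the added vertex.\<close>

lemma triple_number_U_0_aux:
  assumes "U = {}" "3 \<le> packing_number Z A"
  shows "\<exists>D. triple_dominating D \<and> card D = 4"
proof -
  obtain b where b: "b \<in> B" using classes_nonempty assms by auto
  obtain X where X: "X \<subseteq> A" "disjoint_family_on Z X" "card X = 3"
    using packing_number_obtain[OF finite(2) assms(2)] .
  have "\<exists>D. triple_dominating D \<and> card D = card U + card X + card {b}"
  proof (rule ex_triple_dominating)
    show "3 \<le> card U + card {b} + card (X - Z v)" if "v \<in> B" for v
      using card_packing_Diff[OF X(1,2) that] X(3) by simp
  qed (use b assms X classes_nonempty in auto)
  then show ?thesis using assms(1) X(3) by simp
qed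

lemma triple_number_U_0_ge_4:
  assumes "U = {}" "4 \<le> packing_number Z A + packing_number Z B"
  shows "triple_number = 4"
proof -
  consider "3 \<le> packing_number Z A" | "3 \<le> packing_number Z B"
    | "2 \<le> packing_number Z A" "2 \<le> packing_number Z B" using assms(2) by linarith
  then have "\<exists>D. triple_dominating D \<and> card D = 4"
  proof cases
    case 1
    then show ?thesis using triple_number_U_0_aux assms by blast
  next
    case 2
    then show ?thesis
      using co_bipartite.triple_number_U_0_aux[OF swap assms(1)] swap_triple_dominating by simp
  next
    case 3
    \<comment> \<open>With a packing of two in each class, a vertex sees both chosen vertices of its
      own class and at least one of the other.\<close>
    obtain X where X: "X \<subseteq> A" "disjoint_family_on Z X" "card X = 2"
      using packing_number_obtain[OF finite(2) 3(1)] .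
    obtain Y where Y: "Y \<subseteq> B" "disjoint_family_on Z Y" "card Y = 2"
      using packing_number_obtain[OF finite(3) 3(2)] .
    have "\<exists>D. triple_dominating D \<and> card D = card U + card X + card Y"
    proof (rule ex_triple_dominating)
      show "3 \<le> card U + card X + card (Y - Z v)" if "v \<in> A" for v
        using co_bipartite.card_packing_Diff[OF swap Y(1,2) that] X(3) Y(3) by simp
      show "3 \<le> card U + card Y + card (X - Z v)" if "v \<in> B" for v
        using card_packing_Diff[OF X(1,2) that] X(3) Y(3) by simp
    qed (use assms X Y classes_nonempty in auto)
    moreover have "card U + card X + card Y = 4" using assms(1) X(3) Y(3) by simp
    ultimately show ?thesis by simp
  qed
  then obtain D where "triple_dominating D" "card D = 4" by blast
  then show ?thesis using card_ge_4 assms(1) by (intro triple_number_eqI) auto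
qed

text \<open>Each class contains a vertex missing the whole other class, so \<open>D\<close> needs
  three elements in each class; any three from each suffice.\<close>

lemma triple_number_U_0_1_1:
  assumes "U = {}" "packing_number Z A = 1" "packing_number Z B = 1"
  shows "triple_number = 6"
proof -
  have ne: "A \<noteq> {}" "B \<noteq> {}" using classes_nonempty assms by auto
  have "3 \<le> card A" "3 \<le> card B"
    using card_B_ge_3 co_bipartite.card_B_ge_3[OF swap] assms ne by auto
  then obtain X Y where XY: "X \<subseteq> A" "card X = 3" "Y \<subseteq> B" "card Y = 3"
    by (metis obtain_subset_with_card_n)
  have "\<exists>D. triple_dominating D \<and> card D = card U + card X + card Y"
    by (rule ex_triple_dominating) (use XY ne in auto)
  then obtain D where "triple_dominating D" "card D = 6" using assms(1) XY by auto
  then show ?thesis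
  proof (rule triple_number_eqI)
    fix D assume D: "triple_dominating D"
    have "3 \<le> card (D \<inter> B)" using card_Int_B_ge_3 assms ne D by auto
    moreover have "3 \<le> card (D \<inter> A)"
      using co_bipartite.card_Int_B_ge_3[OF swap] swap_triple_dominating assms ne D by auto
    moreover have "card ((D \<inter> A) \<union> (D \<inter> B)) = card (D \<inter> A) + card (D \<inter> B)"
      using disjoint finite by (intro card_Un_disjoint) auto
    moreover have "card ((D \<inter> A) \<union> (D \<inter> B)) \<le> card D"
      using triple_dominating_finite[OF D] by (intro card_mono) auto
    ultimately show "6 \<le> card D" by linarith
  qed
qed

text \<open>The witness has three vertices of \<open>A\<close>, two of them forming a packing, and
  two vertices of \<open>B\<close>. Conversely, packing number 1 of \<open>B\<close> forces three
  elements of \<open>D\<close> into \<open>A\<close>, more than a packing of \<open>A\<close> can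
  have, and \<open>card_ge_5\<close> applies.\<close>

lemma triple_number_U_0_2_1:
  assumes "U = {}" "packing_number Z A = 2" "packing_number Z B = 1"
  shows "triple_number = 5"
proof -
  have ne: "A \<noteq> {}" "B \<noteq> {}" using classes_nonempty assms by auto
  obtain P where P: "P \<subseteq> A" "disjoint_family_on Z P" "card P = 2"
    using packing_number_obtain[OF finite(2), of 2 Z] assms by auto
  have "3 \<le> card A" using co_bipartite.card_B_ge_3[OF swap] assms ne by auto
  then obtain X where X: "P \<subseteq> X" "X \<subseteq> A" "card X = 3"
    using exists_subset_between[of P 3 A] P finite(2) by auto
  have "2 \<le> card B" using co_bipartite.card_A_ge_2[OF swap] assms by simp
  then obtain Y where Y: "Y \<subseteq> B" "card Y = 2" by (metis obtain_subset_with_card_n)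
  have "1 \<le> card (X - Z b)" if "b \<in> B" for b
  proof -
    have "card P - 1 \<le> card (P - Z b)" using P that by (intro card_packing_Diff) auto
    also have "\<dots> \<le> card (X - Z b)"
      using X finite_subset[OF X(2) finite(2)] by (intro card_mono) auto
    finally show ?thesis using P by simp
  qed
  then have "3 \<le> card U + card Y + card (X - Z b)" if "b \<in> B" for b
    using that Y by fastforce
  then have "\<exists>D. triple_dominating D \<and> card D = card U + card X + card Y"
    by (intro ex_triple_dominating) (use X Y ne in auto)
  then obtain D where "triple_dominating D" "card D = 5" using assms(1) X Y by auto
  then show ?thesis
  proof (rule triple_number_eqI)
    fix D assume D: "triple_dominating D"
    have "3 \<le> card (D \<inter> A)"
      using co_bipartite.card_Int_B_ge_3[OF swap] swap_triple_dominating assms ne D by auto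
    then show "5 \<le> card D" using card_ge_5[OF D, of "D \<inter> A"] assms by auto
  qed
qed

lemma triple_number_U_0_3:
  assumes "U = {}" "packing_number Z A + packing_number Z B = 3"
  shows "triple_number = 5"
proof -
  have "A \<noteq> {}" "B \<noteq> {}" using classes_nonempty assms by auto
  then have "1 \<le> packing_number Z A" "1 \<le> packing_number Z B"
    using packing_number_pos co_bipartite.packing_number_pos[OF swap] by auto
  then consider "packing_number Z A = 2" "packing_number Z B = 1"
    | "packing_number Z A = 1" "packing_number Z B = 2" using assms(2) by linarith
  then show ?thesis
  proof cases
    case 1
    then show ?thesis using triple_number_U_0_2_1 assms by blast
  next
    case 2
    then have "co_bipartite.triple_number U B A Z = 5"
      using co_bipartite.triple_number_U_0_2_1[OF swap] assms by blast
    then show ?thesis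
      by (simp add: co_bipartite.triple_number_def[OF swap] triple_number_def swap_triple_dominating)
  qed
qed

end

section \<open>Independence numbers as packing numbers\<close>

text \<open>Packings depend only on which members are disjoint. This transfers them from positions
  in an ordering to vertices.\<close>

lemma packing_number_image:
  assumes inj: "inj_on f A"
    and "\<And>x y. x \<in> A \<Longrightarrow> y \<in> A \<Longrightarrow> Z (f x) \<inter> Z (f y) = {} \<longleftrightarrow> F x \<inter> F y = {}"
  shows "packing_number Z (f ` A) = packing_number F A"
proof -
  have dj: "disjoint_family_on Z (f ` S) \<longleftrightarrow> disjoint_family_on F S" if S: "S \<subseteq> A" for S
  proof -
    have "f x = f y \<longleftrightarrow> x = y" "Z (f x) \<inter> Z (f y) = {} \<longleftrightarrow> F x \<inter> F y = {}"
      if "x \<in> S" "y \<in> S" for x y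
      using that S inj assms(2) by (auto simp: inj_on_def subset_iff)
    then show ?thesis by (simp add: disjoint_family_on_def)
  qed
  have "{S. S \<subseteq> f ` A \<and> disjoint_family_on Z S} = (`) f ` {S. S \<subseteq> A \<and> disjoint_family_on F S}"
    (is "?L = ?R")
  proof
    show "?L \<subseteq> ?R"
    proof
      fix T assume T: "T \<in> ?L"
      then obtain S where "S \<subseteq> A" "T = f ` S" by (auto simp: subset_image_iff)
      then show "T \<in> ?R" using T dj by auto
    qed
    show "?R \<subseteq> ?L" using dj by auto
  qed
  then have "card ` {S. S \<subseteq> f ` A \<and> disjoint_family_on Z S} =
    (\<lambda>S. card (f ` S)) ` {S. S \<subseteq> A \<and> disjoint_family_on F S}"
    by (simp add: image_image)
  also have "\<dots> = card ` {S. S \<subseteq> A \<and> disjoint_family_on F S}"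
    by (intro image_cong) (auto intro: card_image inj_on_subset[OF inj])
  finally show ?thesis by (simp add: packing_number_def)
qed

lemma independence_number_intersection_graph:
  "independence_number (with_proj (intersection_graph A F)) = packing_number F A"
proof -
  have "independent_set (with_proj (intersection_graph A F)) S \<longleftrightarrow> S \<subseteq> A \<and> disjoint_family_on F S" for S
    unfolding independent_set_def intersection_graph_def disjoint_family_on_def by auto
  then show ?thesis by (simp add: independence_number_def packing_number_def)
qed

section \<open>Neighbourhoods in simple graphs\<close>

context graph
begin

lemma dominates_sym: "v \<rightarrow>\<^bsub>G\<^esub> w \<longleftrightarrow> w \<rightarrow>\<^bsub>G\<^esub> v"
  using arcs_ends_symmetric[OF sym_arcs] by blast

text \<open>Without parallel arcs, out-arcs correspond to neighbours; without loops,
  \<open>v\<close> itself adds one more.\<close>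

lemma card_closed_nbhd: "card (closed_nbhd G v) = Suc (out_degree G v)"
proof -
  have nb: "{w. v \<rightarrow>\<^bsub>G\<^esub> w} = head G ` out_arcs G v" by (auto simp: arcs_ends_conv out_arcs_def)
  have "inj_on (head G) (out_arcs G v)"
    using no_multi_arcs by (auto simp: inj_on_def arc_to_ends_def)
  then have "card {w. v \<rightarrow>\<^bsub>G\<^esub> w} = out_degree G v"
    unfolding nb out_degree_def by (rule card_image)
  moreover have "finite {w. v \<rightarrow>\<^bsub>G\<^esub> w}" unfolding nb out_arcs_def by simp
  moreover have "v \<notin> {w. v \<rightarrow>\<^bsub>G\<^esub> w}" using adj_not_same[of v] by auto
  ultimately show ?thesis unfolding closed_nbhd_def by (metis card_insert_disjoint)
qed

lemma closed_nbhd_subset: "v \<in> verts G \<Longrightarrow> closed_nbhd G v \<subseteq> verts G"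
  using adj_in_verts by (auto simp: closed_nbhd_def)

end

section \<open>The two cliques read off a consecutive ordering\<close>

locale consecutive_graph = graph G for G :: "('a, 'b) pre_digraph" +
  fixes vs :: "'a list"
  assumes ordering: "consecutive_ordering (G \<restriction> (verts G - universal_vertices G)) vs"
begin

abbreviation "U \<equiv> universal_vertices G"
abbreviation "G' \<equiv> G \<restriction> (verts G - U)"
abbreviation "zeros \<equiv> zero_rows (length vs) (Mstar G' vs)"
abbreviation "A \<equiv> (!) vs ` C1 G' vs"
abbreviation "B \<equiv> (!) vs ` C2 G' vs"

text \<open>Taking non-neighbours in all of \<open>G\<close> gives the empty set on
  \<open>U\<close>; for other vertices they all lie in \<open>G'\<close>.\<close>

definition "Z v = verts G - closed_nbhd G v"

lemma distinct_vs: "distinct vs" and set_vs: "set vs = verts G - U"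
  using ordering by (auto simp: consecutive_ordering_def vertex_ordering_def)

lemma inj_nth: "inj_on ((!) vs) {..<length vs}"
  using distinct_vs by (intro inj_on_nth) auto

lemma nth_vs: "i < length vs \<Longrightarrow> vs ! i \<in> verts G - U"
  using set_vs nth_mem by blast

lemma mem_zeros_iff:
  assumes "i < length vs" "j < length vs"
  shows "i \<in> zeros j \<longleftrightarrow> vs ! i \<in> Z (vs ! j)"
proof -
  have "vs ! i \<rightarrow>\<^bsub>G'\<^esub> vs ! j \<longleftrightarrow> vs ! i \<rightarrow>\<^bsub>G\<^esub> vs ! j"
    using nth_vs[OF assms(1)] nth_vs[OF assms(2)] by (auto simp: arcs_ends_conv induce_subgraph_def)
  moreover have "vs ! i = vs ! j \<longleftrightarrow> i = j"
    using assms distinct_vs by (simp add: nth_eq_iff_index_eq)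
  ultimately show ?thesis
    using assms nth_vs[OF assms(1)] dominates_sym
    by (auto simp: zero_rows_def Mstar_def Z_def closed_nbhd_def)
qed

lemma Z_nth:
  assumes j: "j < length vs"
  shows "Z (vs ! j) = (!) vs ` zeros j"
proof
  show "Z (vs ! j) \<subseteq> (!) vs ` zeros j"
  proof
    fix x assume x: "x \<in> Z (vs ! j)"
    then have "x \<noteq> vs ! j" "x \<in> verts G" "\<not> x \<rightarrow>\<^bsub>G\<^esub> vs ! j"
      using dominates_sym by (auto simp: Z_def closed_nbhd_def)
    \<comment> \<open>A universal vertex would be adjacent to \<open>vs ! j\<close>, so
      \<open>x\<close> is not universal and occurs in \<open>vs\<close>.\<close>
    then have "x \<in> set vs" using nth_vs[OF j] by (auto simp: set_vs universal_vertices_def)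
    then obtain i where "i < length vs" "x = vs ! i" by (auto simp: in_set_conv_nth)
    then show "x \<in> (!) vs ` zeros j" using x mem_zeros_iff[OF _ j] by blast
  qed
  show "(!) vs ` zeros j \<subseteq> Z (vs ! j)"
    using mem_zeros_iff[OF _ j] by (auto simp: zero_rows_def)
qed

lemma zeros_interval:
  assumes j: "j < length vs"
  obtains p q where "zeros j = {p..q}" "p \<le> q" "Min (zeros j) = p" "Max (zeros j) = q"
proof -
  obtain p q where pq: "zeros j = {p..q}"
    using ordering j unfolding consecutive_ordering_def consecutive_zeros_def by blast
  \<comment> \<open>A non-universal vertex has a non-neighbour, so the interval is nonempty and
    \<open>Min\<close> and \<open>Max\<close> are its endpoints.\<close>
  obtain w where "w \<in> Z (vs ! j)"
    using nth_vs[OF j] by (auto simp: universal_vertices_def Z_def closed_nbhd_def)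
  then have "p \<le> q" using Z_nth[OF j] pq by auto
  then have "Min (zeros j) = p" "Max (zeros j) = q" unfolding pq by (auto intro!: Min_eqI Max_eqI)
  with pq \<open>p \<le> q\<close> show thesis by (rule that)
qed

lemma not_mem_zeros: "j \<notin> zeros j"
  by (simp add: zero_rows_def Mstar_def)

text \<open>Diagonal entries are 1, so the nonempty interval of zeros of column \<open>j\<close>
  avoids \<open>j\<close> and lies entirely on one side of it.\<close>

lemma C1_C2: "C1 G' vs \<union> C2 G' vs = {..<length vs}" "C1 G' vs \<inter> C2 G' vs = {}"
proof -
  have "j \<in> C1 G' vs \<longleftrightarrow> j \<notin> C2 G' vs" if j: "j < length vs" for j
  proof -
    obtain p q where "zeros j = {p..q}" "p \<le> q" using zeros_interval[OF j] .
    then show ?thesis using not_mem_zeros[of j] j by (auto simp: C1_def C2_def)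
  qed
  then show "C1 G' vs \<union> C2 G' vs = {..<length vs}" "C1 G' vs \<inter> C2 G' vs = {}"
    by (auto simp: C1_def C2_def)
qed

lemma A_B: "A \<union> B = verts G - U" "A \<inter> B = {}"
proof -
  have "A \<union> B = (!) vs ` {..<length vs}" by (simp add: C1_C2(1) flip: image_Un)
  also have "\<dots> = set vs" by (auto simp: set_conv_nth)
  finally show "A \<union> B = verts G - U" using set_vs by simp
  have "A \<inter> B = (!) vs ` (C1 G' vs \<inter> C2 G' vs)"
    using C1_C2(1) by (intro inj_on_image_Int[OF inj_nth, symmetric]) auto
  then show "A \<inter> B = {}" using C1_C2(2) by simp
qed

lemma mem_Z_sym: "v \<in> verts G \<Longrightarrow> w \<in> verts G \<Longrightarrow> v \<in> Z w \<longleftrightarrow> w \<in> Z v"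
  using dominates_sym by (auto simp: Z_def closed_nbhd_def)

lemma mem_zeros_sym: "i \<in> zeros j \<Longrightarrow> j < length vs \<Longrightarrow> j \<in> zeros i"
  using mem_zeros_iff mem_Z_sym nth_vs by (auto simp: zero_rows_def)

lemma zeros_nonempty:
  assumes "j < length vs"
  shows "zeros j \<noteq> {}"
proof -
  obtain p q where "zeros j = {p..q}" "p \<le> q" using zeros_interval[OF assms] .
  then show ?thesis by simp
qed

text \<open>By symmetry of the matrix, a zero below the diagonal in column \<open>j\<close> and row
  \<open>i\<close> is a zero above the diagonal in column \<open>i\<close>. This is how the class
  turns out to be a clique.\<close>

lemma zeros_C1:
  assumes j: "j \<in> C1 G' vs"
  shows "zeros j \<subseteq> C2 G' vs"
proof
  fix i assume i: "i \<in> zeros j"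
  then have "j < i" "i < length vs" using j by (auto simp: C1_def zero_rows_def)
  moreover have "j \<in> zeros i" using mem_zeros_sym[OF i] j by (simp add: C1_def)
  ultimately have "i \<notin> C1 G' vs" by (force simp: C1_def)
  then show "i \<in> C2 G' vs" using C1_C2(1) \<open>i < length vs\<close> by blast
qed

lemma zeros_C2:
  assumes j: "j \<in> C2 G' vs"
  shows "zeros j \<subseteq> C1 G' vs"
proof
  fix i assume i: "i \<in> zeros j"
  then have "i < j" "i < length vs" using j by (auto simp: C2_def zero_rows_def)
  moreover have "j \<in> zeros i" using mem_zeros_sym[OF i] j by (simp add: C2_def)
  ultimately have "i \<notin> C2 G' vs" by (force simp: C2_def)
  then show "i \<in> C1 G' vs" using C1_C2(1) \<open>i < length vs\<close> by blast
qed

lemma Z_A_subset: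
  assumes "a \<in> A"
  shows "Z a \<subseteq> B \<and> Z a \<noteq> {}"
proof -
  obtain j where j: "j \<in> C1 G' vs" "a = vs ! j" using assms by blast
  then have "j < length vs" by (simp add: C1_def)
  then show ?thesis
    using image_mono[OF zeros_C1[OF j(1)], of "(!) vs"] zeros_nonempty[of j]
    by (simp add: j(2) Z_nth)
qed

lemma Z_B_subset:
  assumes "b \<in> B"
  shows "Z b \<subseteq> A \<and> Z b \<noteq> {}"
proof -
  obtain j where j: "j \<in> C2 G' vs" "b = vs ! j" using assms by blast
  then have "j < length vs" by (simp add: C2_def)
  then show ?thesis
    using image_mono[OF zeros_C2[OF j(1)], of "(!) vs"] zeros_nonempty[of j]
    by (simp add: j(2) Z_nth)
qed

text \<open>Helly's theorem is applied to positions, where the zeros of a column form an interval;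
  the common row is then read as a vertex.\<close>

lemma Helly_Z:
  assumes J: "J \<subseteq> {..<length vs}" and "(!) vs ` J \<noteq> {}"
    and meet: "\<And>x y. x \<in> (!) vs ` J \<Longrightarrow> y \<in> (!) vs ` J \<Longrightarrow> Z x \<inter> Z y \<noteq> {}"
  shows "\<exists>b. \<forall>a \<in> (!) vs ` J. b \<in> Z a"
proof -
  have "\<exists>k. \<forall>j\<in>J. k \<in> zeros j"
  proof (rule Helly_intervals)
    show "finite J" using J finite_subset by blast
    show "zeros j = {Min (zeros j)..Max (zeros j)}" if "j \<in> J" for j
    proof -
      have "j < length vs" using that J by auto
      then obtain p q where pq: "zeros j = {p..q}" "p \<le> q" "Min (zeros j) = p" "Max (zeros j) = q"
        by (rule zeros_interval)
      show ?thesis unfolding pq(3,4) by (rule pq(1))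
    qed
    show "zeros i \<inter> zeros j \<noteq> {}" if i: "i \<in> J" and j: "j \<in> J" for i j
    proof -
      have ij: "i < length vs" "j < length vs" using i j J by auto
      obtain x where "x \<in> Z (vs ! i)" "x \<in> Z (vs ! j)"
        using meet[OF imageI[OF i] imageI[OF j]] by blast
      then obtain k l where kl: "k \<in> zeros i" "l \<in> zeros j" "vs ! k = vs ! l"
        using Z_nth ij by auto
      then have "k = l" using inj_nth by (auto simp: zero_rows_def inj_on_def)
      then show ?thesis using kl by blast
    qed
  qed (use assms(2) in auto)
  then obtain k where "\<forall>j\<in>J. k \<in> zeros j" ..
  then have "\<forall>a \<in> (!) vs ` J. vs ! k \<in> Z a" using J Z_nth by auto
  then show ?thesis ..
qed

text \<open>Real intervals with natural endpoints that meet share the larger left endpoint, which is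
  natural, so passing to the reals creates no new intersections.\<close>

lemma zero_interval_disjoint_iff:
  assumes i: "i < length vs" and j: "j < length vs"
  shows "Z (vs ! i) \<inter> Z (vs ! j) = {} \<longleftrightarrow> zero_interval G' vs i \<inter> zero_interval G' vs j = {}"
proof -
  obtain p q where pq: "zeros i = {p..q}" "p \<le> q" "Min (zeros i) = p" "Max (zeros i) = q"
    using zeros_interval[OF i] .
  obtain p' q' where pq': "zeros j = {p'..q'}" "p' \<le> q'" "Min (zeros j) = p'" "Max (zeros j) = q'"
    using zeros_interval[OF j] .
  have "Z (vs ! i) \<inter> Z (vs ! j) = (!) vs ` (zeros i \<inter> zeros j)"
    unfolding Z_nth[OF i] Z_nth[OF j]
    by (intro inj_on_image_Int[OF inj_nth, symmetric]) (auto simp: zero_rows_def)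
  then show ?thesis
    by (simp add: zero_interval_def pq(3,4) pq'(3,4)) (auto simp: pq(1) pq'(1) pq(2) pq'(2))
qed

lemma independence_numbers:
  "independence_number (with_proj (H1 G' vs)) = packing_number Z A"
  "independence_number (with_proj (H2 G' vs)) = packing_number Z B"
proof -
  have "C1 G' vs \<subseteq> {..<length vs}" "C2 G' vs \<subseteq> {..<length vs}" using C1_C2(1) by auto
  then have "packing_number Z A = packing_number (zero_interval G' vs) (C1 G' vs)"
    "packing_number Z B = packing_number (zero_interval G' vs) (C2 G' vs)"
    by (auto intro!: packing_number_image inj_on_subset[OF inj_nth] zero_interval_disjoint_iff)
  then show "independence_number (with_proj (H1 G' vs)) = packing_number Z A"
    "independence_number (with_proj (H2 G' vs)) = packing_number Z B"
    by (simp_all add: H1_def H2_def independence_number_intersection_graph)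
qed

lemma verts_eq: "U \<union> A \<union> B = verts G"
  using A_B(1) by (auto simp: universal_vertices_def)

lemma co_bipartite:
  assumes "verts G \<noteq> {}" "2 \<le> min_degree G"
  shows "co_bipartite U A B Z"
proof
  show "finite U" "finite A" "finite B"
    using finite_verts verts_eq by (metis finite_Un)+
  show "U \<inter> A = {}" "U \<inter> B = {}" "A \<inter> B = {}" using A_B by blast+
  show "Z u = {}" if "u \<in> U" for u
    using that by (auto simp: Z_def closed_nbhd_def universal_vertices_def)
  show "b \<in> Z a \<longleftrightarrow> a \<in> Z b" if "a \<in> A" "b \<in> B" for a b
    using that A_B(1) by (intro mem_Z_sym) blast+
  \<comment> \<open>Outside \<open>Z v\<close> lies exactly the closed neighbourhood, whose size is
    the degree plus one.\<close>
  show "3 \<le> card (U \<union> A \<union> B - Z v)" if v: "v \<in> U \<union> A \<union> B" for v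
  proof -
    have v: "v \<in> verts G" using v verts_eq by simp
    then have "2 \<le> out_degree G v"
      using assms(2) unfolding min_degree_def by (meson Min_le finite_imageI finite_verts imageI le_trans)
    moreover have "verts G - Z v = closed_nbhd G v" using closed_nbhd_subset[OF v] by (auto simp: Z_def)
    ultimately show ?thesis using card_closed_nbhd[of v] by (simp add: verts_eq)
  qed
  show "U \<union> A \<union> B \<noteq> {}" using verts_eq assms by simp
  have C: "C1 G' vs \<subseteq> {..<length vs}" "C2 G' vs \<subseteq> {..<length vs}" using C1_C2(1) by auto
  show "\<exists>b. \<forall>a\<in>A. b \<in> Z a" if "A \<noteq> {}" "\<And>x y. x \<in> A \<Longrightarrow> y \<in> A \<Longrightarrow> Z x \<inter> Z y \<noteq> {}"
    using Helly_Z[OF C(1)] that by blast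
  show "\<exists>a. \<forall>b\<in>B. a \<in> Z b" if "B \<noteq> {}" "\<And>x y. x \<in> B \<Longrightarrow> y \<in> B \<Longrightarrow> Z x \<inter> Z y \<noteq> {}"
    using Helly_Z[OF C(2)] that by blast
qed (use Z_A_subset Z_B_subset in blast)+

lemma k_tuple_domination_number_eq:
  assumes "co_bipartite U A B Z"
  shows "k_tuple_domination_number 3 G = co_bipartite.triple_number U A B Z"
proof -
  have "closed_nbhd G v \<inter> D = D - Z v" if "D \<subseteq> verts G" for v D
    using that by (auto simp: Z_def)
  then have "k_tuple_dominating 3 G = co_bipartite.triple_dominating U A B Z"
    unfolding fun_eq_iff k_tuple_dominating_def co_bipartite.triple_dominating_def[OF assms] verts_eq
    by auto
  then show ?thesis
    by (simp add: k_tuple_domination_number_def co_bipartite.triple_number_def[OF assms])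
qed

end

theorem theorem4p8:
  fixes G G' :: "('a, 'b) pre_digraph" and U :: "'a set" and vs :: "'a list" and \<alpha>\<^sub>1 \<alpha>\<^sub>2 :: nat
  assumes "graph G" and "connected G" and "co_biconvex G" and "min_degree G \<ge> 2"
    and "U = universal_vertices G"
    and "G' = G \<restriction> (verts G - U)"
    and "consecutive_ordering G' vs"
    and "\<alpha>\<^sub>1 = independence_number (with_proj (H1 G' vs))"
    and "\<alpha>\<^sub>2 = independence_number (with_proj (H2 G' vs))"
  shows "(card U = 1 \<longrightarrow>
            (\<alpha>\<^sub>1 + \<alpha>\<^sub>2 \<ge> 3 \<longrightarrow> k_tuple_domination_number 3 G = 4) \<and>
            (\<alpha>\<^sub>1 + \<alpha>\<^sub>2 = 2 \<longrightarrow> k_tuple_domination_number 3 G = 5)) \<and>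
         (card U = 2 \<longrightarrow> k_tuple_domination_number 3 G = 4) \<and>
         (card U \<ge> 3 \<longrightarrow> k_tuple_domination_number 3 G = 3) \<and>
         (card U = 0 \<and> \<alpha>\<^sub>1 + \<alpha>\<^sub>2 \<ge> 4 \<longrightarrow> k_tuple_domination_number 3 G = 4) \<and>
         (card U = 0 \<and> \<alpha>\<^sub>1 = 1 \<and> \<alpha>\<^sub>2 = 1 \<longrightarrow> k_tuple_domination_number 3 G = 6) \<and>
         (card U = 0 \<and> \<alpha>\<^sub>1 + \<alpha>\<^sub>2 = 3 \<longrightarrow> k_tuple_domination_number 3 G = 5)"
proof -
  interpret consecutive_graph G vs
    using assms(1,5,6,7) by (simp add: consecutive_graph_def consecutive_graph_axioms_def)
  have "verts G \<noteq> {}" using assms(2) by (auto simp: connected_def strongly_connected_def)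
  then interpret co_bipartite "universal_vertices G" A B Z
    using assms(4) by (rule co_bipartite)
  have \<alpha>: "\<alpha>\<^sub>1 = packing_number Z A" "\<alpha>\<^sub>2 = packing_number Z B"
    using assms(5,6,8,9) independence_numbers by simp_all
  \<comment> \<open>Cardinality 0 alone would allow an infinite set; finiteness of \<open>U\<close>
    makes it empty.\<close>
  have "card U = 0 \<Longrightarrow> universal_vertices G = {}" using assms(5) finite(1) by simp
  then show ?thesis
    using triple_number_U_1_ge_3 triple_number_U_1_2 triple_number_U_2 triple_number_U_ge_3
      triple_number_U_0_ge_4 triple_number_U_0_1_1 triple_number_U_0_3
    unfolding k_tuple_domination_number_eq[OF co_bipartite_axioms] \<alpha> assms(5) by blast
qed

end
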